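(* Let $\alpha$ be a set with an involution $\tau\colon\alpha\to\alpha$. The element $\gamma(w)\in\Pi$ is a homotopy invariant of a nanoword $w$ over $\alpha$; that is, if two nanowords $w,w'$ over $\alpha$ are homotopic, then $\gamma(w)=\gamma(w')$.
   Context: Fix a set $\alpha$ with an involution $\tau\colon\alpha\to\alpha$. An $\alpha$-alphabet is a set $\mathcal{A}$ with a map $\mathcal{A}\to\alpha$, $A\mapsto|A|$. A nanoword over $\alpha$ is a pair $(\mathcal{A},w)$, where $\mathcal{A}$ is a finite $\alpha$-alphabet and $w$ is a word (finite sequence) in letters of $\mathcal{A}$ in which every letter of $\mathcal{A}$ appears exactly twice. Two nanowords $(\mathcal{A}_1,w_1)$ and $(\mathcal{A}_2,w_2)$ are isomorphic if there is a bijection $f\colon\mathcal{A}_1\to\mathcal{A}_2$ with $|f(A)|=|A|$ for all $A$ that sends $w_1$ letterwise to $w_2$. Homotopy of nanowords is the equivalence relation generated by isomorphisms and the following three moves and their inverses: (i) $(\mathcal{A},xAAy)\mapsto(\mathcal{A}-\{A\},xy)$, where $x,y$ are words on $\mathcal{A}-\{A\}$; (ii) $(\mathcal{A},xAByBAz)\mapsto(\mathcal{A}-\{A,B\},xyz)$ if $|A|=\tau(|B|)$, where $x,y,z$ are words on $\mathcal{A}-\{A,B\}$; (iii) $(\mathcal{A},xAByACzBCt)\mapsto(\mathcal{A},xBAyCAzCBt)$ if $|A|=|B|=|C|$, where $x,y,z,t$ are words on $\mathcal{A}-\{A,B,C\}$. Here $A$, $B$, $C$ are distinct letters of $\mathcal{A}$.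 Let $\Pi$ be the group with generators $\{z_a\}_{a\in\alpha}$ and defining relations $z_az_{\tau(a)}=1$ for all $a\in\alpha$. For a nanoword $(\mathcal{A},w)$ of length $n$ with letters $w(1),\dots,w(n)$, set $\gamma_i=z_{|w(i)|}$ if $w(i)\ne w(j)$ for all $j<i$, and $\gamma_i=z_{|w(i)|}^{-1}$ otherwise. Put $\gamma(w)=\gamma_1\gamma_2\cdots\gamma_n\in\Pi$. *)

theory Defs
  imports "HOL-Algebra.Coset"
begin

section \<open>Groups given by generators and relations\<close>

text \<open>
  The letter \<open>(s, True)\<close> stands for the generator \<open>s\<close> and \<open>(s, False)\<close> for its formal inverse.
  Elements of the free group are classes of such signed words modulo insertion and deletion of
  \<open>s s\<^sup>-\<^sup>1\<close> and \<open>s\<^sup>-\<^sup>1 s\<close>.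
\<close>

definition signed_words :: "'s set \<Rightarrow> ('s \<times> bool) list set" where
  "signed_words S = lists (S \<times> UNIV)"

inductive free_cancel :: "'s set \<Rightarrow> ('s \<times> bool) list \<Rightarrow> ('s \<times> bool) list \<Rightarrow> bool"
  for S :: "'s set" where
  "\<lbrakk>u \<in> signed_words S; v \<in> signed_words S; s \<in> S\<rbrakk>
     \<Longrightarrow> free_cancel S (u @ [(s, b), (s, \<not> b)] @ v) (u @ v)"

definition free_rel :: "'s set \<Rightarrow> (('s \<times> bool) list \<times> ('s \<times> bool) list) set" where
  "free_rel S = {(u, v). u \<in> signed_words S \<and> v \<in> signed_words S \<and> equivclp (free_cancel S) u v}"

definition free_group :: "'s set \<Rightarrow> ('s \<times> bool) list set monoid" where
  "free_group S = \<lparr>carrier = signed_words S // free_rel S,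
     monoid.mult = (\<lambda>X Y. \<Union>u\<in>X. \<Union>v\<in>Y. free_rel S `` {u @ v}),
     one = free_rel S `` {[]}\<rparr>"

definition free_gen :: "'s set \<Rightarrow> 's \<Rightarrow> ('s \<times> bool) list set" where
  "free_gen S s = free_rel S `` {[(s, True)]}"

definition normal_closure :: "('g, 'm) monoid_scheme \<Rightarrow> 'g set \<Rightarrow> 'g set" where
  "normal_closure G R = \<Inter>{N. N \<lhd> G \<and> R \<subseteq> N}"

definition presented_group ::
    "'s set \<Rightarrow> ('s \<times> bool) list set set \<Rightarrow> ('s \<times> bool) list set set monoid" where
  "presented_group S R = free_group S Mod normal_closure (free_group S) R"

definition presented_gen ::
    "'s set \<Rightarrow> ('s \<times> bool) list set set \<Rightarrow> 's \<Rightarrow> ('s \<times> bool) list set set" where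
  "presented_gen S R s =
     normal_closure (free_group S) R #>\<^bsub>free_group S\<^esub> free_gen S s"

lemma equiv_free_rel: "equiv (signed_words S) (free_rel S)"
  unfolding equiv_def refl_on_def sym_on_def trans_on_def free_rel_def
  by (auto intro: equivclp_trans equivclp_sym)

lemma signed_words_append [simp]:
  "u @ v \<in> signed_words S \<longleftrightarrow> u \<in> signed_words S \<and> v \<in> signed_words S"
  by (auto simp: signed_words_def)

lemma signed_words_Nil [simp]: "[] \<in> signed_words S"
  by (auto simp: signed_words_def)

lemma free_cancel_context:
  assumes "free_cancel S u v" "x \<in> signed_words S" "y \<in> signed_words S"
  shows "free_cancel S (x @ u @ y) (x @ v @ y)"
  using assms(1)
proof cases
  case (1 p q s b)
  then show ?thesis
    using free_cancel.intros[of "x @ p" S "q @ y" s b] assms(2,3) by simp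
qed

lemma equivclp_free_cancel_context:
  assumes "equivclp (free_cancel S) u v" "x \<in> signed_words S" "y \<in> signed_words S"
  shows "equivclp (free_cancel S) (x @ u @ y) (x @ v @ y)"
  using assms(1)
proof (induction rule: equivclp_induct)
  case base
  show ?case by simp
next
  case (step v w)
  then show ?case
    using free_cancel_context[OF _ assms(2,3)] by (meson equivclp_into_equivclp)
qed

lemma free_rel_append:
  assumes "(u, u') \<in> free_rel S" "(v, v') \<in> free_rel S"
  shows "(u @ v, u' @ v') \<in> free_rel S"
proof -
  have "equivclp (free_cancel S) (u @ v) (u' @ v)"
    using equivclp_free_cancel_context[of S u u' "[]" v] assms by (auto simp: free_rel_def)
  moreover have "equivclp (free_cancel S) (u' @ v) (u' @ v')"
    using equivclp_free_cancel_context[of S v v' u' "[]"] assms by (auto simp: free_rel_def)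
  ultimately show ?thesis
    using assms by (auto simp: free_rel_def intro: equivclp_trans)
qed

lemma free_group_mult:
  assumes "u \<in> signed_words S" "v \<in> signed_words S"
  shows "free_rel S `` {u} \<otimes>\<^bsub>free_group S\<^esub> free_rel S `` {v} = free_rel S `` {u @ v}"
proof -
  have "congruent2 (free_rel S) (free_rel S) (\<lambda>u v. free_rel S `` {u @ v})"
    unfolding congruent2_def
    by (auto intro!: equiv_class_eq[OF equiv_free_rel] free_rel_append)
  then show ?thesis
    using UN_equiv_class2[OF equiv_free_rel equiv_free_rel _ assms] by (simp add: free_group_def)
qed

lemma free_group_carrier_cases:
  assumes "X \<in> carrier (free_group S)"
  obtains u where "u \<in> signed_words S" "X = free_rel S `` {u}"
  using assms by (auto simp: free_group_def elim: quotientE)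

lemma free_class_closed [simp]:
  "u \<in> signed_words S \<Longrightarrow> free_rel S `` {u} \<in> carrier (free_group S)"
  by (simp add: free_group_def quotientI)

lemma free_group_one: "\<one>\<^bsub>free_group S\<^esub> = free_rel S `` {[]}"
  by (simp add: free_group_def)

lemma free_inverse_word:
  assumes "u \<in> signed_words S"
  shows "\<exists>v\<in>signed_words S. (v @ u, []) \<in> free_rel S"
  using assms
proof (induction u)
  case Nil
  then show ?case by (auto simp: free_rel_def intro!: bexI[of _ "[]"])
next
  case (Cons p u)
  obtain s b where p: "p = (s, b)" by (cases p)
  have s: "s \<in> S" and u: "u \<in> signed_words S"
    using Cons.prems p by (auto simp: signed_words_def)
  then obtain v where v: "v \<in> signed_words S" "(v @ u, []) \<in> free_rel S"
    using Cons.IH by blast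
  have "free_cancel S (v @ [(s, \<not> b), (s, \<not> \<not> b)] @ u) (v @ u)"
    by (rule free_cancel.intros) (use u v s in auto)
  then have "equivclp (free_cancel S) ((v @ [(s, \<not> b)]) @ p # u) []"
    using v p by (auto simp: free_rel_def intro: equivclp_trans r_into_equivclp)
  moreover have "v @ [(s, \<not> b)] \<in> signed_words S"
    using v s by (auto simp: signed_words_def)
  ultimately show ?case
    using Cons.prems by (auto simp: free_rel_def intro!: bexI[of _ "v @ [(s, \<not> b)]"])
qed

lemma group_free_group: "group (free_group S)"
proof (rule groupI)
  fix X assume "X \<in> carrier (free_group S)"
  then obtain u where u: "u \<in> signed_words S" "X = free_rel S `` {u}"
    by (rule free_group_carrier_cases)
  then obtain v where v: "v \<in> signed_words S" "(v @ u, []) \<in> free_rel S"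
    using free_inverse_word by blast
  then have "free_rel S `` {v} \<otimes>\<^bsub>free_group S\<^esub> X = \<one>\<^bsub>free_group S\<^esub>"
    using u by (simp add: free_group_mult free_group_one equiv_class_eq[OF equiv_free_rel])
  then show "\<exists>Y\<in>carrier (free_group S). Y \<otimes>\<^bsub>free_group S\<^esub> X = \<one>\<^bsub>free_group S\<^esub>"
    using v by (auto intro!: bexI[of _ "free_rel S `` {v}"])
qed (auto elim!: free_group_carrier_cases simp: free_group_mult free_group_one)

lemma normal_closure_normal:
  assumes "group G" "R \<subseteq> carrier G"
  shows "normal_closure G R \<lhd> G"
proof -
  interpret group G by fact
  let ?\<N> = "{N. N \<lhd> G \<and> R \<subseteq> N}"
  have "carrier G \<in> ?\<N>"
    using assms(2) normal_invI[OF subgroup_self] by auto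
  then have "subgroup (normal_closure G R) G"
    unfolding normal_closure_def
    by (intro subgroups_Inter) (auto simp: normal_imp_subgroup)
  then show ?thesis
    by (rule normal_invI) (auto simp: normal_closure_def normal.inv_op_closed2)
qed

lemma free_gen_closed: "s \<in> S \<Longrightarrow> free_gen S s \<in> carrier (free_group S)"
  unfolding free_gen_def by (rule free_class_closed) (simp add: signed_words_def)

lemma group_presented_group:
  assumes "R \<subseteq> carrier (free_group S)"
  shows "group (presented_group S R)"
  unfolding presented_group_def
  by (intro normal.factorgroup_is_group normal_closure_normal group_free_group assms)

lemma presented_gen_closed:
  "s \<in> S \<Longrightarrow> presented_gen S R s \<in> carrier (presented_group S R)"
  by (auto simp: presented_gen_def presented_group_def FactGroup_def RCOSETS_def free_gen_closed)


section \<open>Nanowords and their homotopy\<close>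

text \<open>
  Only the values of \<open>proj\<close> on \<open>letters\<close> are significant; the isomorphisms below identify
  nanowords that differ elsewhere.
\<close>

record ('a, 'l) nanoword =
  letters :: "'l set"
  proj :: "'l \<Rightarrow> 'a"
  nword :: "'l list"

definition is_nanoword :: "'a set \<Rightarrow> ('a, 'l) nanoword \<Rightarrow> bool" where
  "is_nanoword \<alpha> N \<longleftrightarrow>
     finite (letters N) \<and> proj N \<in> letters N \<rightarrow> \<alpha> \<and> nword N \<in> lists (letters N) \<and>
     (\<forall>A\<in>letters N. count_list (nword N) A = 2)"

definition nanoword_iso :: "('a, 'l) nanoword \<Rightarrow> ('a, 'm) nanoword \<Rightarrow> bool" where
  "nanoword_iso N N' \<longleftrightarrow>
     (\<exists>f. bij_betw f (letters N) (letters N') \<and> (\<forall>A\<in>letters N. proj N' (f A) = proj N A) \<and>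
          nword N' = map f (nword N))"

text \<open>
  New letters for inverse moves come from the type \<open>'l\<close>, so this is the full homotopy relation
  for infinite \<open>'l\<close>. As alphabets are finite, any chain of moves and isomorphisms can be
  carried out inside such a type.
\<close>

inductive homotopy_step ::
    "'a set \<Rightarrow> ('a \<Rightarrow> 'a) \<Rightarrow> ('a, 'l) nanoword \<Rightarrow> ('a, 'l) nanoword \<Rightarrow> bool"
  for \<alpha> :: "'a set" and \<tau> :: "'a \<Rightarrow> 'a" where
  iso: "\<lbrakk>is_nanoword \<alpha> N; is_nanoword \<alpha> N'; nanoword_iso N N'\<rbrakk> \<Longrightarrow> homotopy_step \<alpha> \<tau> N N'"
| move1: "\<lbrakk>is_nanoword \<alpha> \<lparr>letters = L, proj = p, nword = x @ [A, A] @ y\<rparr>;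
     A \<in> L; set x \<union> set y \<subseteq> L - {A}\<rbrakk>
   \<Longrightarrow> homotopy_step \<alpha> \<tau> \<lparr>letters = L, proj = p, nword = x @ [A, A] @ y\<rparr>
                         \<lparr>letters = L - {A}, proj = p, nword = x @ y\<rparr>"
| move2: "\<lbrakk>is_nanoword \<alpha> \<lparr>letters = L, proj = p, nword = x @ [A, B] @ y @ [B, A] @ z\<rparr>;
     A \<in> L; B \<in> L; A \<noteq> B; p A = \<tau> (p B);
     set x \<union> set y \<union> set z \<subseteq> L - {A, B}\<rbrakk>
   \<Longrightarrow> homotopy_step \<alpha> \<tau> \<lparr>letters = L, proj = p, nword = x @ [A, B] @ y @ [B, A] @ z\<rparr>
                         \<lparr>letters = L - {A, B}, proj = p, nword = x @ y @ z\<rparr>"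
| move3: "\<lbrakk>is_nanoword \<alpha>
       \<lparr>letters = L, proj = p, nword = x @ [A, B] @ y @ [A, C] @ z @ [B, C] @ t\<rparr>;
     A \<in> L; B \<in> L; C \<in> L; A \<noteq> B; A \<noteq> C; B \<noteq> C; p A = p B; p B = p C;
     set x \<union> set y \<union> set z \<union> set t \<subseteq> L - {A, B, C}\<rbrakk>
   \<Longrightarrow> homotopy_step \<alpha> \<tau>
         \<lparr>letters = L, proj = p, nword = x @ [A, B] @ y @ [A, C] @ z @ [B, C] @ t\<rparr>
         \<lparr>letters = L, proj = p, nword = x @ [B, A] @ y @ [C, A] @ z @ [C, B] @ t\<rparr>"

definition homotopic ::
    "'a set \<Rightarrow> ('a \<Rightarrow> 'a) \<Rightarrow> ('a, 'l) nanoword \<Rightarrow> ('a, 'l) nanoword \<Rightarrow> bool" where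
  "homotopic \<alpha> \<tau> = equivclp (homotopy_step \<alpha> \<tau>)"


section \<open>The group \<open>\<Pi>\<close> and the element \<open>\<gamma>\<close>\<close>

definition Pi_relators :: "'a set \<Rightarrow> ('a \<Rightarrow> 'a) \<Rightarrow> ('a \<times> bool) list set set" where
  "Pi_relators \<alpha> \<tau> = (\<lambda>a. free_gen \<alpha> a \<otimes>\<^bsub>free_group \<alpha>\<^esub> free_gen \<alpha> (\<tau> a)) ` \<alpha>"

definition Pi_group :: "'a set \<Rightarrow> ('a \<Rightarrow> 'a) \<Rightarrow> ('a \<times> bool) list set set monoid" where
  "Pi_group \<alpha> \<tau> = presented_group \<alpha> (Pi_relators \<alpha> \<tau>)"

definition Pi_gen :: "'a set \<Rightarrow> ('a \<Rightarrow> 'a) \<Rightarrow> 'a \<Rightarrow> ('a \<times> bool) list set set" where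
  "Pi_gen \<alpha> \<tau> a = presented_gen \<alpha> (Pi_relators \<alpha> \<tau>) a"

definition gamma_letter ::
    "'a set \<Rightarrow> ('a \<Rightarrow> 'a) \<Rightarrow> ('a, 'l) nanoword \<Rightarrow> nat \<Rightarrow> ('a \<times> bool) list set set" where
  "gamma_letter \<alpha> \<tau> N i =
     (let z = Pi_gen \<alpha> \<tau> (proj N (nword N ! i))
      in if \<forall>j<i. nword N ! i \<noteq> nword N ! j then z else inv\<^bsub>Pi_group \<alpha> \<tau>\<^esub> z)"

definition gamma ::
    "'a set \<Rightarrow> ('a \<Rightarrow> 'a) \<Rightarrow> ('a, 'l) nanoword \<Rightarrow> ('a \<times> bool) list set set" where
  "gamma \<alpha> \<tau> N =
     foldr (\<otimes>\<^bsub>Pi_group \<alpha> \<tau>\<^esub>) (map (gamma_letter \<alpha> \<tau> N) [0..<length (nword N)])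
       \<one>\<^bsub>Pi_group \<alpha> \<tau>\<^esub>"

lemma Pi_relators_closed:
  assumes "\<tau> \<in> \<alpha> \<rightarrow> \<alpha>"
  shows "Pi_relators \<alpha> \<tau> \<subseteq> carrier (free_group \<alpha>)"
proof -
  interpret group "free_group \<alpha>" by (rule group_free_group)
  show ?thesis
    using assms by (auto simp: Pi_relators_def free_gen_closed Pi_iff)
qed

lemma group_Pi_group: "\<tau> \<in> \<alpha> \<rightarrow> \<alpha> \<Longrightarrow> group (Pi_group \<alpha> \<tau>)"
  unfolding Pi_group_def by (intro group_presented_group Pi_relators_closed)

lemma Pi_gen_closed: "a \<in> \<alpha> \<Longrightarrow> Pi_gen \<alpha> \<tau> a \<in> carrier (Pi_group \<alpha> \<tau>)"
  unfolding Pi_group_def Pi_gen_def by (rule presented_gen_closed)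

lemma gamma_closed:
  assumes "\<tau> \<in> \<alpha> \<rightarrow> \<alpha>" "is_nanoword \<alpha> N"
  shows "gamma \<alpha> \<tau> N \<in> carrier (Pi_group \<alpha> \<tau>)"
proof -
  interpret group "Pi_group \<alpha> \<tau>" by (rule group_Pi_group) fact
  have "gamma_letter \<alpha> \<tau> N i \<in> carrier (Pi_group \<alpha> \<tau>)" if "i < length (nword N)" for i
  proof -
    have "nword N ! i \<in> letters N"
      using assms(2) that by (auto simp: is_nanoword_def)
    then have "proj N (nword N ! i) \<in> \<alpha>"
      using assms(2) by (auto simp: is_nanoword_def)
    then show ?thesis
      by (simp add: gamma_letter_def Let_def Pi_gen_closed)
  qed
  then have "foldr (\<otimes>\<^bsub>Pi_group \<alpha> \<tau>\<^esub>) (map (gamma_letter \<alpha> \<tau> N) is)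
      \<one>\<^bsub>Pi_group \<alpha> \<tau>\<^esub> \<in> carrier (Pi_group \<alpha> \<tau>)"
    if "set is \<subseteq> {..<length (nword N)}" for "is"
    using that by (induction "is") auto
  then show ?thesis
    unfolding gamma_def by (metis atLeast_upt order_refl)
qed

end

theory Submission
  imports Defs
begin

text \<open>
  Homotopy is generated by single steps, so it suffices that \<open>\<gamma>\<close> takes the same value at both
  ends of a step. The two occurrences of a letter \<open>A\<close> contribute \<open>z\<close> and then \<open>z\<^sup>-\<^sup>1\<close> with
  \<open>z = z\<^bsub>|A|\<^esub>\<close>, and a move does not alter the contributions of the letters that it leaves in place.
  The first move therefore deletes \<open>z z\<^sup>-\<^sup>1\<close>. The second deletes \<open>z\<^bsub>|A|\<^esub> z\<^bsub>|B|\<^esub>\<close> at one place and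
  its inverse \<open>z\<^bsub>|B|\<^esub>\<^sup>-\<^sup>1 z\<^bsub>|A|\<^esub>\<^sup>-\<^sup>1\<close> at another, and the product is trivial by the defining relations
  of \<open>\<Pi>\<close> (\<open>Pi_gen_relation\<close>). In the third all three letters contribute powers of one generator,
  so the transposed neighbours commute: the blocks are \<open>z z\<close>, \<open>z\<^sup>-\<^sup>1 z\<close> and \<open>z\<^sup>-\<^sup>1 z\<^sup>-\<^sup>1\<close>.

  Apart from the triviality of \<open>z\<^bsub>|A|\<^esub> z\<^bsub>|B|\<^esub>\<close> in the second move, these computations use only the
  group laws. They are therefore carried out in an arbitrary group, for the product
  \<open>signed_prod\<close> of values assigned to the letters, each inverted at its later occurrences;
  \<open>gamma_eq_signed_prod\<close> identifies \<open>\<gamma>\<close> as an instance.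
\<close>

text \<open>
  The set \<open>S\<close> holds the letters that occurred earlier. Carrying it along makes the product
  recursive in the word, hence compatible with concatenation, although the sign of a letter
  depends on everything before it.
\<close>

primrec signed_prod ::
    "('g, 'm) monoid_scheme \<Rightarrow> ('l \<Rightarrow> 'g) \<Rightarrow> 'l set \<Rightarrow> 'l list \<Rightarrow> 'g" where
  "signed_prod G g S [] = \<one>\<^bsub>G\<^esub>"
| "signed_prod G g S (A # w) =
     (if A \<in> S then inv\<^bsub>G\<^esub> (g A) else g A) \<otimes>\<^bsub>G\<^esub> signed_prod G g (insert A S) w"

lemma (in group) signed_prod_closed:
  "g \<in> set w \<rightarrow> carrier G \<Longrightarrow> signed_prod G g S w \<in> carrier G"
  by (induction w arbitrary: S) (auto simp: Pi_iff)

lemma (in group) signed_prod_append: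
  assumes "g \<in> set u \<union> set v \<rightarrow> carrier G"
  shows "signed_prod G g S (u @ v) = signed_prod G g S u \<otimes> signed_prod G g (S \<union> set u) v"
  using assms
proof (induction u arbitrary: S)
  case Nil
  then show ?case by (simp add: signed_prod_closed)
next
  case (Cons A u)
  then have "g A \<in> carrier G" "g \<in> set u \<rightarrow> carrier G" "g \<in> set v \<rightarrow> carrier G"
    "g \<in> set u \<union> set v \<rightarrow> carrier G"
    by auto
  then show ?case
    using Cons.IH[of "insert A S"] by (auto simp: m_assoc signed_prod_closed)
qed

lemma signed_prod_insert_fresh:
  "A \<notin> set w \<Longrightarrow> signed_prod G g (insert A S) w = signed_prod G g S w"
  by (induction w arbitrary: S) (auto simp: insert_commute[of _ A])

lemma signed_prod_map:
  assumes "inj_on f L" "S \<union> set w \<subseteq> L" "\<forall>A\<in>set w. g' (f A) = g A"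
  shows "signed_prod G g' (f ` S) (map f w) = signed_prod G g S w"
  using assms(2,3)
proof (induction w arbitrary: S)
  case (Cons A w)
  then have "f A \<in> f ` S \<longleftrightarrow> A \<in> S"
    using inj_on_image_mem_iff[OF assms(1), of A S] by auto
  then show ?case
    using Cons.IH[of "insert A S"] Cons.prems by simp
qed simp

text \<open>
  The sign of a letter is fixed by a quantifier over the earlier positions; shifting the positions
  by one turns the first of them into a member of the set of letters that occurred earlier.
\<close>

lemma foldr_eq_signed_prod:
  "foldr (\<otimes>\<^bsub>G\<^esub>)
     (map (\<lambda>i. if w ! i \<notin> S \<and> (\<forall>j<i. w ! i \<noteq> w ! j) then g (w ! i) else inv\<^bsub>G\<^esub> g (w ! i))
       [0..<length w]) \<one>\<^bsub>G\<^esub> = signed_prod G g S w"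
proof (induction w arbitrary: S)
  case (Cons A w)
  have "w ! i \<notin> S \<and> (\<forall>j<Suc i. w ! i \<noteq> (A # w) ! j) \<longleftrightarrow>
      w ! i \<notin> insert A S \<and> (\<forall>j<i. w ! i \<noteq> w ! j)" for i
    by (auto simp: less_Suc_eq_0_disj)
  then show ?case
    using Cons.IH[of "insert A S"] by (simp add: map_upt_Suc del: upt_Suc cong: if_cong)
qed simp

lemma gamma_eq_signed_prod:
  "gamma \<alpha> \<tau> N =
     signed_prod (Pi_group \<alpha> \<tau>) (\<lambda>A. Pi_gen \<alpha> \<tau> (proj N A)) {} (nword N)"
  using foldr_eq_signed_prod[of "Pi_group \<alpha> \<tau>" "nword N" "{}" "\<lambda>A. Pi_gen \<alpha> \<tau> (proj N A)"]
  by (simp add: gamma_def gamma_letter_def[abs_def] Let_def)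

lemma (in group) signed_prod_move1:
  assumes "g \<in> insert A (set x \<union> set y) \<rightarrow> carrier G" "A \<notin> set x \<union> set y"
  shows "signed_prod G g {} (x @ [A, A] @ y) = signed_prod G g {} (x @ y)"
proof -
  have closed: "g A \<in> carrier G" "g \<in> set x \<rightarrow> carrier G" "g \<in> set y \<rightarrow> carrier G"
    using assms by auto
  then show ?thesis
    using assms(2)
    by (simp add: signed_prod_append signed_prod_insert_fresh signed_prod_closed Pi_iff ball_Un
        m_assoc[symmetric])
qed

lemma (in group) signed_prod_move2:
  assumes "g \<in> {A, B} \<union> set x \<union> set y \<union> set z \<rightarrow> carrier G"
    and "A \<noteq> B" "{A, B} \<inter> (set x \<union> set y \<union> set z) = {}"
    and rel: "g A \<otimes> g B = \<one>"
  shows "signed_prod G g {} (x @ [A, B] @ y @ [B, A] @ z) = signed_prod G g {} (x @ y @ z)"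
proof -
  have closed: "g A \<in> carrier G" "g B \<in> carrier G"
    "g \<in> set x \<rightarrow> carrier G" "g \<in> set y \<rightarrow> carrier G" "g \<in> set z \<rightarrow> carrier G"
    using assms(1) by auto
  have cancel: "g A \<otimes> (g B \<otimes> h) = h" "inv (g B) \<otimes> (inv (g A) \<otimes> h) = h"
    if "h \<in> carrier G" for h
    using that closed rel inv_mult_group[of "g A" "g B"] by (simp_all add: m_assoc[symmetric])
  show ?thesis
    using assms(2,3) closed
    by (simp add: signed_prod_append signed_prod_insert_fresh signed_prod_closed Pi_iff ball_Un
        cancel m_assoc)
qed

lemma (in group) signed_prod_move3:
  assumes "g \<in> {A, B, C} \<union> set x \<union> set y \<union> set z \<union> set t \<rightarrow> carrier G"
    and "A \<noteq> B" "A \<noteq> C" "B \<noteq> C" "{A, B, C} \<inter> (set x \<union> set y \<union> set z \<union> set t) = {}"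
    and eq: "g A = g B" "g B = g C"
  shows "signed_prod G g {} (x @ [A, B] @ y @ [A, C] @ z @ [B, C] @ t) =
    signed_prod G g {} (x @ [B, A] @ y @ [C, A] @ z @ [C, B] @ t)"
proof -
  have closed: "g C \<in> carrier G"
    "g \<in> set x \<rightarrow> carrier G" "g \<in> set y \<rightarrow> carrier G" "g \<in> set z \<rightarrow> carrier G"
    "g \<in> set t \<rightarrow> carrier G"
    using assms(1) by auto
  \<comment> \<open>The block \<open>AC\<close> contributes \<open>z\<^sup>-\<^sup>1 z\<close> and the block \<open>CA\<close> contributes \<open>z z\<^sup>-\<^sup>1\<close>.\<close>
  have cancel: "g C \<otimes> (inv (g C) \<otimes> h) = h" "inv (g C) \<otimes> (g C \<otimes> h) = h"
    if "h \<in> carrier G" for h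
    using that closed by (simp_all add: m_assoc[symmetric])
  show ?thesis
    using assms(2-5) closed
    by (simp add: signed_prod_append signed_prod_insert_fresh signed_prod_closed Pi_iff ball_Un
        cancel eq m_assoc)
qed

text \<open>A relator lies in the normal closure, so its coset is the identity of the quotient.\<close>

lemma Pi_gen_relation:
  assumes \<tau>: "\<tau> \<in> \<alpha> \<rightarrow> \<alpha>" and a: "a \<in> \<alpha>"
  shows "Pi_gen \<alpha> \<tau> a \<otimes>\<^bsub>Pi_group \<alpha> \<tau>\<^esub> Pi_gen \<alpha> \<tau> (\<tau> a) = \<one>\<^bsub>Pi_group \<alpha> \<tau>\<^esub>"
proof -
  let ?F = "free_group \<alpha>" and ?r = "free_gen \<alpha> a \<otimes>\<^bsub>free_group \<alpha>\<^esub> free_gen \<alpha> (\<tau> a)"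
  let ?K = "normal_closure ?F (Pi_relators \<alpha> \<tau>)"
  interpret normal ?K ?F
    by (rule normal_closure_normal[OF group_free_group Pi_relators_closed[OF \<tau>]])
  have "?r \<in> ?K"
    using a by (auto simp: normal_closure_def Pi_relators_def)
  then have "?K #>\<^bsub>?F\<^esub> ?r = ?K"
    by (rule rcos_const[OF group_free_group])
  moreover have "free_gen \<alpha> a \<in> carrier ?F" "free_gen \<alpha> (\<tau> a) \<in> carrier ?F"
    using \<tau> a by (auto intro: free_gen_closed)
  ultimately show ?thesis
    by (simp add: Pi_gen_def Pi_group_def presented_gen_def presented_group_def FactGroup_def
        rcos_sum)
qed

lemma gamma_homotopy_step:
  assumes \<tau>: "\<tau> \<in> \<alpha> \<rightarrow> \<alpha>" and invol: "\<forall>a\<in>\<alpha>. \<tau> (\<tau> a) = a"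
    and step: "homotopy_step \<alpha> \<tau> N N'"
  shows "gamma \<alpha> \<tau> N = gamma \<alpha> \<tau> N'"
proof -
  interpret group "Pi_group \<alpha> \<tau>" by (rule group_Pi_group) fact
  have closed: "(\<lambda>A. Pi_gen \<alpha> \<tau> (p A)) \<in> M \<rightarrow> carrier (Pi_group \<alpha> \<tau>)"
    if "is_nanoword \<alpha> \<lparr>letters = L, proj = p, nword = w\<rparr>" "M \<subseteq> L"
    for L M :: "'b set" and p w
    using that by (auto simp: is_nanoword_def Pi_iff intro: Pi_gen_closed)
  show ?thesis
    using step
  proof cases
    case iso
    then obtain f where f: "inj_on f (letters N)" "\<forall>A\<in>letters N. proj N' (f A) = proj N A"
      "nword N' = map f (nword N)"
      by (auto simp: nanoword_iso_def bij_betw_def)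
    moreover have "set (nword N) \<subseteq> letters N"
      using iso by (auto simp: is_nanoword_def)
    ultimately show ?thesis
      using signed_prod_map[of f "letters N" "{}" "nword N" "\<lambda>A. Pi_gen \<alpha> \<tau> (proj N' A)"
          "\<lambda>A. Pi_gen \<alpha> \<tau> (proj N A)" "Pi_group \<alpha> \<tau>"]
      by (simp add: gamma_eq_signed_prod subset_iff)
  next
    case (move1 L p x A y)
    show ?thesis
      unfolding move1(1,2) gamma_eq_signed_prod nanoword.select_convs
      by (rule signed_prod_move1[OF closed[OF move1(3)]]) (use move1(4-) in auto)
  next
    case (move2 L p x A B y z)
    have "p B \<in> \<alpha>"
      using move2 by (auto simp: is_nanoword_def)
    \<comment> \<open>The defining relation indexed by \<open>|A| = \<tau> |B|\<close> has the factors in the order in which they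
      occur here; its second index is \<open>\<tau> |A| = |B|\<close> because \<open>\<tau>\<close> is an involution.\<close>
    then have rel: "Pi_gen \<alpha> \<tau> (p A) \<otimes>\<^bsub>Pi_group \<alpha> \<tau>\<^esub> Pi_gen \<alpha> \<tau> (p B) = \<one>\<^bsub>Pi_group \<alpha> \<tau>\<^esub>"
      using Pi_gen_relation[OF \<tau>, of "\<tau> (p B)"] \<tau> invol move2(7) by auto
    show ?thesis
      unfolding move2(1,2) gamma_eq_signed_prod nanoword.select_convs
      by (rule signed_prod_move2[OF closed[OF move2(3)]]) (use rel move2(4-) in auto)
  next
    case (move3 L p x A B y C z t)
    show ?thesis
      unfolding move3(1,2) gamma_eq_signed_prod nanoword.select_convs
      by (rule signed_prod_move3[OF closed[OF move3(3)]]) (use move3(4-) in auto)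
  qed
qed

theorem theorem5p1:
  fixes \<alpha> :: "'a set" and \<tau> :: "'a \<Rightarrow> 'a" and w w' :: "('a, 'l) nanoword"
  assumes "\<tau> \<in> \<alpha> \<rightarrow> \<alpha>" and "\<forall>a\<in>\<alpha>. \<tau> (\<tau> a) = a"
    and "is_nanoword \<alpha> w" and "is_nanoword \<alpha> w'"
    and "homotopic \<alpha> \<tau> w w'"
  shows "gamma \<alpha> \<tau> w = gamma \<alpha> \<tau> w'"
proof -
  have "equivclp (homotopy_step \<alpha> \<tau>) w w'"
    using assms(5) by (simp add: homotopic_def)
  then show ?thesis
  proof (induction rule: equivclp_induct)
    case (step v u)
    then show ?case
      using gamma_homotopy_step[OF assms(1,2)] by metis
  qed simp
qed

end
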